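(* Every rule of the relational Hoare logic RHL+ is sound: for every instance of a rule, if all its judgment premises are valid and all its side conditions hold, then its conclusion is valid.
   Context: Stores: total functions $\mathit{Var}\to\mathbb{Z}$. GCL commands $c::=\mathsf{skip}\mid x:=e\mid\mathsf{havoc}\,x\mid c;c\mid\mathsf{if}\,gcs\,\mathsf{fi}\mid\mathsf{do}\,gcs\,\mathsf{od}$ (labels ignored), $gcs$ a nonempty list of guarded commands $e\to c$, boolean expressions built from primitive ones ($bprim$) by $\wedge,\vee,\neg$, $\mathrm{enab}(gcs)$ the disjunction of guards; commands well typed with $\mathrm{enab}(gcs)$ valid for every $\mathsf{if}\,gcs\,\mathsf{fi}$. Denotation $\llbracket c\rrbracket$: identity for skip; $\{(s,s[x\mapsto\llbracket e\rrbracket(s)])\}$ for $x:=e$; $\{(s,s[x\mapsto v])\mid v\in\mathbb{Z}\}$ for havoc; composition for $;$; for $\mathsf{if}$, union over $e\to c$ of $\{(s,t)\mid e$ true in $s,(s,t)\in\llbracket c\rrbracket\}$; for $\mathsf{do}$, pairs $(s,t)$ reached by finitely many steps each executing an enabled guarded command's body, ending in a store where $\mathrm{enab}(gcs)$ is false. Store relations $\mathcal{R}\subseteq$ Store$\times$Store; a boolean expression $e$ denotes $\{s\mid e\text{ true in }s\}$; $\langle P]=\{(s,s')\mid s\in P\}$, $[P\rangle=\{(s,s')\mid s'\in P\}$; $\langle e|=|e'\rangle=\{(s,s')\mid\llbracket e\rrbracket(s)=\llbracket e'\rrbracket(s')\}$; $\wedge,\vee,\neg,\Rightarrow$ on relations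 are intersection, union, complement, inclusion. $\mathcal{R}[x|:=e|]=\{(s,s')\mid(s[x\mapsto\llbracket e\rrbracket(s)],s')\in\mathcal{R}\}$, $\mathcal{R}[|x:=|e]$ symmetric on the right; $(\forall x|.\mathcal{R})=\{(s,s')\mid\forall v.\,(s[x\mapsto v],s')\in\mathcal{R}\}$, $(\forall|x.\mathcal{R})$ symmetric. $\mathrm{indep}(x|x',\mathcal{R})$ means $\mathcal{R}=\{(s,s')\mid\exists v,v'.\,(s[x\mapsto v],s'[x'\mapsto v'])\in\mathcal{R}\}$. Valid judgment $\models c\mid c':\langle\mathcal{R}\Rightarrow\mathcal{S}\rangle$: for all $(s,t)\in\llbracket c\rrbracket$, $(s',t')\in\llbracket c'\rrbracket$, $(s,s')\in\mathcal{R}$ implies $(t,t')\in\mathcal{S}$. $\mathrm{ghost}(x,c)$: $x$ occurs in $c$ only as the target of assignments $x:=\dots$ and of $\mathsf{havoc}\,x$; $\mathrm{erase}(x,c)$ replaces each such assignment and havoc by $\mathsf{skip}$. Command equivalence: KAT axioms are those of an idempotent semiring $(\mathbb{K},+,;,0,1)$ with a Boolean subalgebra of tests $\mathbb{B}$ (with $1$ true, $;$ conjunction, $\neg$ complement) and star laws $1+x;x^*=x^*$, $1+x^*;x=x^*$, $y+x;z\le z\Rightarrow x^*;y\le z$, $y+z;x\le z\Rightarrow y;x^*\le z$ ($x\le y$ iff $x+y=y$). KAT expressions $E::=\underline{bprim}\mid\underline{x:=e}\mid\underline{\mathsf{havoc}\,x}\mid E+E\mid E;E\mid E^*\mid\neg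 E\mid1\mid0$; translation $\lfloor\cdot\rfloor$: $\lfloor bprim\rfloor=\underline{bprim}$, $\lfloor\neg e\rfloor=\neg\lfloor e\rfloor$, $\lfloor e\wedge e'\rfloor=\lfloor e\rfloor;\lfloor e'\rfloor$, $\lfloor e\vee e'\rfloor=\lfloor e\rfloor+\lfloor e'\rfloor$, $\lfloor\mathsf{skip}\rfloor=1$, $\lfloor x:=e\rfloor=\underline{x:=e}$, $\lfloor\mathsf{havoc}\,x\rfloor=\underline{\mathsf{havoc}\,x}$, $\lfloor c;d\rfloor=\lfloor c\rfloor;\lfloor d\rfloor$, $\lfloor\mathsf{if}\,gcs\,\mathsf{fi}\rfloor=\lfloor gcs\rfloor$, $\lfloor\mathsf{do}\,gcs\,\mathsf{od}\rfloor=\lfloor gcs\rfloor^*;\neg\lfloor\mathrm{enab}(gcs)\rfloor$, $\lfloor gcs\rfloor=\sum_{e\to c\in gcs}\lfloor e\rfloor;\lfloor c\rfloor$. $\mathrm{Hyp}$ is the set of equations: (a) $\lfloor e\rfloor=0$ for each boolean $e$ with $e\Rightarrow\mathit{false}$ valid; (b) $\lfloor e_0\rfloor;\underline{x:=e};\neg\lfloor e_1\rfloor=0$ whenever $e_0\Rightarrow e_1[x:=e]$ is valid; (c) $\lfloor e_0\rfloor;\underline{\mathsf{havoc}\,x};\neg\lfloor e_1\rfloor=0$ whenever $e_0\Rightarrow\forall x.e_1$ is valid. $c\simeq d$ iff $\lfloor c\rfloor=\lfloor d\rfloor$ is provable by equational and propositional reasoning from $\mathrm{Hyp}$ and the KAT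 axioms. The rules of RHL+ ($\mathcal{L},\mathcal{R},\mathcal{S},\mathcal{T},\mathcal{P},\mathcal{Q}$ store relations): rGhost: from $c\mid c':\langle\mathcal{R}\Rightarrow\mathcal{S}\rangle$, $\mathrm{ghost}(x,c)$, $\mathrm{ghost}(x',c')$, $\mathrm{indep}(x|x',\mathcal{R})$, $\mathrm{indep}(x|x',\mathcal{S})$ infer $\mathrm{erase}(x,c)\mid\mathrm{erase}(x',c'):\langle\mathcal{R}\Rightarrow\mathcal{S}\rangle$. rRewrite: from $c\mid c':\langle\mathcal{R}\Rightarrow\mathcal{S}\rangle$, $c\simeq d$, $c'\simeq d'$ infer $d\mid d':\langle\mathcal{R}\Rightarrow\mathcal{S}\rangle$. rSkip: $\mathsf{skip}\mid\mathsf{skip}:\langle\mathcal{R}\Rightarrow\mathcal{R}\rangle$. rAsgnSkip: $x:=e\mid\mathsf{skip}:\langle\mathcal{R}[x|:=e|]\Rightarrow\mathcal{R}\rangle$; rSkipAsgn: $\mathsf{skip}\mid x:=e:\langle\mathcal{R}[|x:=|e]\Rightarrow\mathcal{R}\rangle$. rHavSkip: $\mathsf{havoc}\,x\mid\mathsf{skip}:\langle(\forall x|.\mathcal{P})\Rightarrow\mathcal{P}\rangle$; rSkipHav: $\mathsf{skip}\mid\mathsf{havoc}\,x:\langle(\forall|x.\mathcal{P})\Rightarrow\mathcal{P}\rangle$. rSeq: from $c\mid c':\langle\mathcal{R}\Rightarrow\mathcal{S}\rangle$ and $d\mid d':\langle\mathcal{S}\Rightarrow\mathcal{T}\rangle$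 infer $c;d\mid c';d':\langle\mathcal{R}\Rightarrow\mathcal{T}\rangle$. rIf: from $c\mid c':\langle\mathcal{R}\wedge\langle e]\wedge[e'\rangle\Rightarrow\mathcal{S}\rangle$ for all $e\to c$ in $gcs$ and $e'\to c'$ in $gcs'$ infer $\mathsf{if}\,gcs\,\mathsf{fi}\mid\mathsf{if}\,gcs'\,\mathsf{fi}:\langle\mathcal{R}\Rightarrow\mathcal{S}\rangle$. rDo: from $c\mid\mathsf{skip}:\langle\mathcal{Q}\wedge\langle e]\wedge\mathcal{L}\Rightarrow\mathcal{Q}\rangle$ for all $e\to c$ in $gcs$; $\mathsf{skip}\mid c':\langle\mathcal{Q}\wedge[e'\rangle\wedge\mathcal{R}\Rightarrow\mathcal{Q}\rangle$ for all $e'\to c'$ in $gcs'$; $c\mid c':\langle\mathcal{Q}\wedge\langle e]\wedge[e'\rangle\wedge\neg\mathcal{L}\wedge\neg\mathcal{R}\Rightarrow\mathcal{Q}\rangle$ for all such pairs; and side condition $\mathcal{Q}\Rightarrow(\langle\mathrm{enab}(gcs)|=|\mathrm{enab}(gcs')\rangle\vee(\mathcal{L}\wedge\langle\mathrm{enab}(gcs)])\vee(\mathcal{R}\wedge[\mathrm{enab}(gcs')\rangle))$, infer $\mathsf{do}\,gcs\,\mathsf{od}\mid\mathsf{do}\,gcs'\,\mathsf{od}:\langle\mathcal{Q}\Rightarrow\mathcal{Q}\wedge\neg\langle\mathrm{enab}(gcs)]\wedge\neg[\mathrm{enab}(gcs')\rangle\rangle$. rConseq: from $\mathcal{P}\Rightarrow\mathcal{R}$,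 $c\mid d:\langle\mathcal{R}\Rightarrow\mathcal{S}\rangle$, $\mathcal{S}\Rightarrow\mathcal{Q}$ infer $c\mid d:\langle\mathcal{P}\Rightarrow\mathcal{Q}\rangle$. rDisj: from $c\mid d:\langle\mathcal{Q}\Rightarrow\mathcal{S}\rangle$ and $c\mid d:\langle\mathcal{R}\Rightarrow\mathcal{S}\rangle$ infer $c\mid d:\langle\mathcal{Q}\vee\mathcal{R}\Rightarrow\mathcal{S}\rangle$. rFalse: $c\mid d:\langle\mathit{false}\Rightarrow\mathcal{R}\rangle$. *)

theory Defs
  imports Main
begin

section \<open>Expressions\<close>

type_synonym 'v store = "'v \<Rightarrow> int"

text \<open>
  The primitive operations of the expression language are a parameter: arbitrary types of function
  symbols \<open>'f\<close> and predicate symbols \<open>'p\<close>, each with an arity and an interpretation. Literals are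
  nullary function symbols.
\<close>

record ('f, 'p) lang =
  fun_arity :: "'f \<Rightarrow> nat"
  fun_sem :: "'f \<Rightarrow> int list \<Rightarrow> int"
  pred_arity :: "'p \<Rightarrow> nat"
  pred_sem :: "'p \<Rightarrow> int list \<Rightarrow> bool"

datatype ('v, 'f) iexp = IVar 'v | IApp 'f "('v, 'f) iexp list"

datatype ('v, 'f, 'p) bprim = BApp 'p "('v, 'f) iexp list"

datatype ('v, 'f, 'p) bexp =
    BPrim "('v, 'f, 'p) bprim"
  | BAnd "('v, 'f, 'p) bexp" "('v, 'f, 'p) bexp"
  | BOr "('v, 'f, 'p) bexp" "('v, 'f, 'p) bexp"
  | BNot "('v, 'f, 'p) bexp"

fun ieval :: "('f, 'p) lang \<Rightarrow> ('v, 'f) iexp \<Rightarrow> 'v store \<Rightarrow> int" where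
  "ieval M (IVar x) s = s x"
| "ieval M (IApp f es) s = fun_sem M f (map (\<lambda>e. ieval M e s) es)"

fun beval :: "('f, 'p) lang \<Rightarrow> ('v, 'f, 'p) bexp \<Rightarrow> 'v store \<Rightarrow> bool" where
  "beval M (BPrim (BApp p es)) s \<longleftrightarrow> pred_sem M p (map (\<lambda>e. ieval M e s) es)"
| "beval M (BAnd a b) s \<longleftrightarrow> beval M a s \<and> beval M b s"
| "beval M (BOr a b) s \<longleftrightarrow> beval M a s \<or> beval M b s"
| "beval M (BNot a) s \<longleftrightarrow> \<not> beval M a s"

fun wt_iexp :: "('f, 'p) lang \<Rightarrow> ('v, 'f) iexp \<Rightarrow> bool" where
  "wt_iexp M (IVar x) \<longleftrightarrow> True"
| "wt_iexp M (IApp f es) \<longleftrightarrow> length es = fun_arity M f \<and> (\<forall>e \<in> set es. wt_iexp M e)"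

fun wt_bexp :: "('f, 'p) lang \<Rightarrow> ('v, 'f, 'p) bexp \<Rightarrow> bool" where
  "wt_bexp M (BPrim (BApp p es)) \<longleftrightarrow> length es = pred_arity M p \<and> (\<forall>e \<in> set es. wt_iexp M e)"
| "wt_bexp M (BAnd a b) \<longleftrightarrow> wt_bexp M a \<and> wt_bexp M b"
| "wt_bexp M (BOr a b) \<longleftrightarrow> wt_bexp M a \<and> wt_bexp M b"
| "wt_bexp M (BNot a) \<longleftrightarrow> wt_bexp M a"

fun ivars :: "('v, 'f) iexp \<Rightarrow> 'v set" where
  "ivars (IVar x) = {x}"
| "ivars (IApp f es) = (\<Union>e \<in> set es. ivars e)"

fun bvars :: "('v, 'f, 'p) bexp \<Rightarrow> 'v set" where
  "bvars (BPrim (BApp p es)) = (\<Union>e \<in> set es. ivars e)"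
| "bvars (BAnd a b) = bvars a \<union> bvars b"
| "bvars (BOr a b) = bvars a \<union> bvars b"
| "bvars (BNot a) = bvars a"

fun isubst :: "'v \<Rightarrow> ('v, 'f) iexp \<Rightarrow> ('v, 'f) iexp \<Rightarrow> ('v, 'f) iexp" where
  "isubst x e (IVar y) = (if y = x then e else IVar y)"
| "isubst x e (IApp f es) = IApp f (map (isubst x e) es)"

fun bsubst :: "'v \<Rightarrow> ('v, 'f) iexp \<Rightarrow> ('v, 'f, 'p) bexp \<Rightarrow> ('v, 'f, 'p) bexp" where
  "bsubst x e (BPrim (BApp p es)) = BPrim (BApp p (map (isubst x e) es))"
| "bsubst x e (BAnd a b) = BAnd (bsubst x e a) (bsubst x e b)"
| "bsubst x e (BOr a b) = BOr (bsubst x e a) (bsubst x e b)"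
| "bsubst x e (BNot a) = BNot (bsubst x e a)"


section \<open>Commands\<close>

text \<open>The type \<open>gcs\<close> is that of nonempty lists of guarded commands.\<close>

datatype ('v, 'f, 'p) com =
    Skip
  | Asgn 'v "('v, 'f) iexp"
  | Havoc 'v
  | Seq "('v, 'f, 'p) com" "('v, 'f, 'p) com"
  | IfFi "('v, 'f, 'p) gcs"
  | DoOd "('v, 'f, 'p) gcs"
and ('v, 'f, 'p) gcs =
    GLast "('v, 'f, 'p) bexp" "('v, 'f, 'p) com"
  | GCons "('v, 'f, 'p) bexp" "('v, 'f, 'p) com" "('v, 'f, 'p) gcs"

primrec gset :: "('v, 'f, 'p) gcs \<Rightarrow> (('v, 'f, 'p) bexp \<times> ('v, 'f, 'p) com) set" where
  "gset (GLast e c) = {(e, c)}"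
| "gset (GCons e c gs) = insert (e, c) (gset gs)"

primrec enab :: "('v, 'f, 'p) gcs \<Rightarrow> ('v, 'f, 'p) bexp" where
  "enab (GLast e c) = e"
| "enab (GCons e c gs) = BOr e (enab gs)"

primrec wf_com :: "('f, 'p) lang \<Rightarrow> ('v, 'f, 'p) com \<Rightarrow> bool"
  and wf_gcs :: "('f, 'p) lang \<Rightarrow> ('v, 'f, 'p) gcs \<Rightarrow> bool" where
  "wf_com M Skip \<longleftrightarrow> True"
| "wf_com M (Asgn x e) \<longleftrightarrow> wt_iexp M e"
| "wf_com M (Havoc x) \<longleftrightarrow> True"
| "wf_com M (Seq c d) \<longleftrightarrow> wf_com M c \<and> wf_com M d"
| "wf_com M (IfFi gs) \<longleftrightarrow> wf_gcs M gs \<and> (\<forall>s. beval M (enab gs) s)"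
| "wf_com M (DoOd gs) \<longleftrightarrow> wf_gcs M gs"
| "wf_gcs M (GLast e c) \<longleftrightarrow> wt_bexp M e \<and> wf_com M c"
| "wf_gcs M (GCons e c gs) \<longleftrightarrow> wt_bexp M e \<and> wf_com M c \<and> wf_gcs M gs"

text \<open>For guarded commands, \<open>gcs_sem\<close> relates the stores before and after one enabled body.\<close>

primrec com_sem :: "('f, 'p) lang \<Rightarrow> ('v, 'f, 'p) com \<Rightarrow> ('v store \<times> 'v store) set"
  and gcs_sem :: "('f, 'p) lang \<Rightarrow> ('v, 'f, 'p) gcs \<Rightarrow> ('v store \<times> 'v store) set" where
  "com_sem M Skip = Id"
| "com_sem M (Asgn x e) = {(s, t). t = s(x := ieval M e s)}"
| "com_sem M (Havoc x) = {(s, t). \<exists>v. t = s(x := v)}"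
| "com_sem M (Seq c d) = com_sem M c O com_sem M d"
| "com_sem M (IfFi gs) = gcs_sem M gs"
| "com_sem M (DoOd gs) = {(s, t). (s, t) \<in> (gcs_sem M gs)\<^sup>* \<and> \<not> beval M (enab gs) t}"
| "gcs_sem M (GLast e c) = {(s, t). beval M e s \<and> (s, t) \<in> com_sem M c}"
| "gcs_sem M (GCons e c gs) = {(s, t). beval M e s \<and> (s, t) \<in> com_sem M c} \<union> gcs_sem M gs"

text \<open>The right-hand side of an assignment to a ghost variable may not mention it either.\<close>

primrec ghost :: "'v \<Rightarrow> ('v, 'f, 'p) com \<Rightarrow> bool"
  and ghost_gcs :: "'v \<Rightarrow> ('v, 'f, 'p) gcs \<Rightarrow> bool" where
  "ghost x Skip \<longleftrightarrow> True"
| "ghost x (Asgn y e) \<longleftrightarrow> x \<notin> ivars e"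
| "ghost x (Havoc y) \<longleftrightarrow> True"
| "ghost x (Seq c d) \<longleftrightarrow> ghost x c \<and> ghost x d"
| "ghost x (IfFi gs) \<longleftrightarrow> ghost_gcs x gs"
| "ghost x (DoOd gs) \<longleftrightarrow> ghost_gcs x gs"
| "ghost_gcs x (GLast e c) \<longleftrightarrow> x \<notin> bvars e \<and> ghost x c"
| "ghost_gcs x (GCons e c gs) \<longleftrightarrow> x \<notin> bvars e \<and> ghost x c \<and> ghost_gcs x gs"

primrec erase :: "'v \<Rightarrow> ('v, 'f, 'p) com \<Rightarrow> ('v, 'f, 'p) com"
  and erase_gcs :: "'v \<Rightarrow> ('v, 'f, 'p) gcs \<Rightarrow> ('v, 'f, 'p) gcs" where
  "erase x Skip = Skip"
| "erase x (Asgn y e) = (if y = x then Skip else Asgn y e)"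
| "erase x (Havoc y) = (if y = x then Skip else Havoc y)"
| "erase x (Seq c d) = Seq (erase x c) (erase x d)"
| "erase x (IfFi gs) = IfFi (erase_gcs x gs)"
| "erase x (DoOd gs) = DoOd (erase_gcs x gs)"
| "erase_gcs x (GLast e c) = GLast e (erase x c)"
| "erase_gcs x (GCons e c gs) = GCons e (erase x c) (erase_gcs x gs)"


section \<open>Command equivalence\<close>

datatype ('v, 'f, 'p) kat =
    KPrim "('v, 'f, 'p) bprim"
  | KAsgn 'v "('v, 'f) iexp"
  | KHavoc 'v
  | KPlus "('v, 'f, 'p) kat" "('v, 'f, 'p) kat"
  | KSeq "('v, 'f, 'p) kat" "('v, 'f, 'p) kat"
  | KStar "('v, 'f, 'p) kat"
  | KNot "('v, 'f, 'p) kat"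
  | KOne
  | KZero

primrec is_test :: "('v, 'f, 'p) kat \<Rightarrow> bool" where
  "is_test (KPrim b) \<longleftrightarrow> True"
| "is_test (KAsgn x e) \<longleftrightarrow> False"
| "is_test (KHavoc x) \<longleftrightarrow> False"
| "is_test (KPlus E F) \<longleftrightarrow> is_test E \<and> is_test F"
| "is_test (KSeq E F) \<longleftrightarrow> is_test E \<and> is_test F"
| "is_test (KStar E) \<longleftrightarrow> False"
| "is_test (KNot E) \<longleftrightarrow> is_test E"
| "is_test KOne \<longleftrightarrow> True"
| "is_test KZero \<longleftrightarrow> True"

primrec btrans :: "('v, 'f, 'p) bexp \<Rightarrow> ('v, 'f, 'p) kat" where
  "btrans (BPrim b) = KPrim b"
| "btrans (BAnd a b) = KSeq (btrans a) (btrans b)"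
| "btrans (BOr a b) = KPlus (btrans a) (btrans b)"
| "btrans (BNot a) = KNot (btrans a)"

primrec ctrans :: "('v, 'f, 'p) com \<Rightarrow> ('v, 'f, 'p) kat"
  and gtrans :: "('v, 'f, 'p) gcs \<Rightarrow> ('v, 'f, 'p) kat" where
  "ctrans Skip = KOne"
| "ctrans (Asgn x e) = KAsgn x e"
| "ctrans (Havoc x) = KHavoc x"
| "ctrans (Seq c d) = KSeq (ctrans c) (ctrans d)"
| "ctrans (IfFi gs) = gtrans gs"
| "ctrans (DoOd gs) = KSeq (KStar (gtrans gs)) (KNot (btrans (enab gs)))"
| "gtrans (GLast e c) = KSeq (btrans e) (ctrans c)"
| "gtrans (GCons e c gs) = KPlus (KSeq (btrans e) (ctrans c)) (gtrans gs)"

text \<open>Formulas of the propositional logic over equations between KAT expressions.\<close>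

datatype ('v, 'f, 'p) form =
    Eq "('v, 'f, 'p) kat" "('v, 'f, 'p) kat"
  | Falsum
  | Imp "('v, 'f, 'p) form" "('v, 'f, 'p) form"

abbreviation Le :: "('v, 'f, 'p) kat \<Rightarrow> ('v, 'f, 'p) kat \<Rightarrow> ('v, 'f, 'p) form" where
  "Le E F \<equiv> Eq (KPlus E F) F"

text \<open>
  The rules \<open>test_...\<close>, together with the semiring axioms, are Huntington's axioms for the
  Boolean algebra of tests.
\<close>

inductive kat_axiom :: "('v, 'f, 'p) form \<Rightarrow> bool" where
  plus_assoc: "kat_axiom (Eq (KPlus (KPlus E F) G) (KPlus E (KPlus F G)))"
| plus_comm: "kat_axiom (Eq (KPlus E F) (KPlus F E))"
| plus_zero: "kat_axiom (Eq (KPlus E KZero) E)"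
| plus_idem: "kat_axiom (Eq (KPlus E E) E)"
| seq_assoc: "kat_axiom (Eq (KSeq (KSeq E F) G) (KSeq E (KSeq F G)))"
| one_seq: "kat_axiom (Eq (KSeq KOne E) E)"
| seq_one: "kat_axiom (Eq (KSeq E KOne) E)"
| zero_seq: "kat_axiom (Eq (KSeq KZero E) KZero)"
| seq_zero: "kat_axiom (Eq (KSeq E KZero) KZero)"
| distrib_left: "kat_axiom (Eq (KSeq E (KPlus F G)) (KPlus (KSeq E F) (KSeq E G)))"
| distrib_right: "kat_axiom (Eq (KSeq (KPlus E F) G) (KPlus (KSeq E G) (KSeq F G)))"
| test_comm: "is_test A \<Longrightarrow> is_test B \<Longrightarrow> kat_axiom (Eq (KSeq A B) (KSeq B A))"
| test_distrib: "is_test A \<Longrightarrow> is_test B \<Longrightarrow> is_test C \<Longrightarrow>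
    kat_axiom (Eq (KPlus A (KSeq B C)) (KSeq (KPlus A B) (KPlus A C)))"
| test_contradiction: "is_test A \<Longrightarrow> kat_axiom (Eq (KSeq A (KNot A)) KZero)"
| test_excluded_middle: "is_test A \<Longrightarrow> kat_axiom (Eq (KPlus A (KNot A)) KOne)"
| star_unfold_left: "kat_axiom (Eq (KPlus KOne (KSeq E (KStar E))) (KStar E))"
| star_unfold_right: "kat_axiom (Eq (KPlus KOne (KSeq (KStar E) E)) (KStar E))"
| star_induct_left: "kat_axiom (Imp (Le (KPlus F (KSeq E G)) G) (Le (KSeq (KStar E) F) G))"
| star_induct_right: "kat_axiom (Imp (Le (KPlus F (KSeq G E)) G) (Le (KSeq F (KStar E)) G))"

inductive hyp :: "('f, 'p) lang \<Rightarrow> ('v, 'f, 'p) form \<Rightarrow> bool" for M where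
  hyp_false: "wt_bexp M e \<Longrightarrow> \<forall>s. \<not> beval M e s \<Longrightarrow> hyp M (Eq (btrans e) KZero)"
| hyp_asgn: "wt_bexp M e0 \<Longrightarrow> wt_iexp M e \<Longrightarrow> wt_bexp M e1 \<Longrightarrow>
    \<forall>s. beval M e0 s \<longrightarrow> beval M (bsubst x e e1) s \<Longrightarrow>
    hyp M (Eq (KSeq (KSeq (btrans e0) (KAsgn x e)) (KNot (btrans e1))) KZero)"
| hyp_havoc: "wt_bexp M e0 \<Longrightarrow> wt_bexp M e1 \<Longrightarrow>
    \<forall>s. beval M e0 s \<longrightarrow> (\<forall>v. beval M e1 (s(x := v))) \<Longrightarrow>
    hyp M (Eq (KSeq (KSeq (btrans e0) (KHavoc x)) (KNot (btrans e1))) KZero)"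

text \<open>
  A Hilbert calculus for classical propositional logic with equality. The KAT axioms are open
  formulas, used through all their instances.
\<close>

inductive provable :: "('f, 'p) lang \<Rightarrow> ('v, 'f, 'p) form \<Rightarrow> bool" for M where
  from_kat: "kat_axiom \<phi> \<Longrightarrow> provable M \<phi>"
| from_hyp: "hyp M \<phi> \<Longrightarrow> provable M \<phi>"
| prop_K: "provable M (Imp \<phi> (Imp \<psi> \<phi>))"
| prop_S: "provable M (Imp (Imp \<phi> (Imp \<psi> \<chi>)) (Imp (Imp \<phi> \<psi>) (Imp \<phi> \<chi>)))"
| prop_DN: "provable M (Imp (Imp (Imp \<phi> Falsum) Falsum) \<phi>)"
| modus_ponens: "provable M (Imp \<phi> \<psi>) \<Longrightarrow> provable M \<phi> \<Longrightarrow> provable M \<psi>"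
| eq_refl: "provable M (Eq E E)"
| eq_sym: "provable M (Imp (Eq E F) (Eq F E))"
| eq_trans: "provable M (Imp (Eq E F) (Imp (Eq F G) (Eq E G)))"
| cong_plus: "provable M (Imp (Eq E E') (Imp (Eq F F') (Eq (KPlus E F) (KPlus E' F'))))"
| cong_seq: "provable M (Imp (Eq E E') (Imp (Eq F F') (Eq (KSeq E F) (KSeq E' F'))))"
| cong_star: "provable M (Imp (Eq E E') (Eq (KStar E) (KStar E')))"
| cong_not: "provable M (Imp (Eq E E') (Eq (KNot E) (KNot E')))"

definition com_equiv :: "('f, 'p) lang \<Rightarrow> ('v, 'f, 'p) com \<Rightarrow> ('v, 'f, 'p) com \<Rightarrow> bool" where
  "com_equiv M c d \<longleftrightarrow> provable M (Eq (ctrans c) (ctrans d))"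


section \<open>Store relations and relational correctness\<close>

type_synonym 'v srel = "('v store \<times> 'v store) set"

definition on_left :: "('f, 'p) lang \<Rightarrow> ('v, 'f, 'p) bexp \<Rightarrow> 'v srel" where
  "on_left M e = {(s, s'). beval M e s}"

definition on_right :: "('f, 'p) lang \<Rightarrow> ('v, 'f, 'p) bexp \<Rightarrow> 'v srel" where
  "on_right M e = {(s, s'). beval M e s'}"

definition agree :: "('f, 'p) lang \<Rightarrow> ('v, 'f, 'p) bexp \<Rightarrow> ('v, 'f, 'p) bexp \<Rightarrow> 'v srel" where
  "agree M e e' = {(s, s'). beval M e s = beval M e' s'}"

definition subst_left :: "('f, 'p) lang \<Rightarrow> 'v srel \<Rightarrow> 'v \<Rightarrow> ('v, 'f) iexp \<Rightarrow> 'v srel" where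
  "subst_left M R x e = {(s, s'). (s(x := ieval M e s), s') \<in> R}"

definition subst_right :: "('f, 'p) lang \<Rightarrow> 'v srel \<Rightarrow> 'v \<Rightarrow> ('v, 'f) iexp \<Rightarrow> 'v srel" where
  "subst_right M R x e = {(s, s'). (s, s'(x := ieval M e s')) \<in> R}"

definition all_left :: "'v \<Rightarrow> 'v srel \<Rightarrow> 'v srel" where
  "all_left x R = {(s, s'). \<forall>v. (s(x := v), s') \<in> R}"

definition all_right :: "'v \<Rightarrow> 'v srel \<Rightarrow> 'v srel" where
  "all_right x R = {(s, s'). \<forall>v. (s, s'(x := v)) \<in> R}"

definition indep :: "'v \<Rightarrow> 'v \<Rightarrow> 'v srel \<Rightarrow> bool" where
  "indep x x' R \<longleftrightarrow> R = {(s, s'). \<exists>v v'. (s(x := v), s'(x' := v')) \<in> R}"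

datatype ('v, 'f, 'p) rjudg =
  Judg "('v, 'f, 'p) com" "('v, 'f, 'p) com" "'v srel" "'v srel"

primrec wf_rjudg :: "('f, 'p) lang \<Rightarrow> ('v, 'f, 'p) rjudg \<Rightarrow> bool" where
  "wf_rjudg M (Judg c c' R S) \<longleftrightarrow> wf_com M c \<and> wf_com M c'"

primrec valid :: "('f, 'p) lang \<Rightarrow> ('v, 'f, 'p) rjudg \<Rightarrow> bool" where
  "valid M (Judg c c' R S) \<longleftrightarrow>
    (\<forall>s t s' t'. (s, t) \<in> com_sem M c \<longrightarrow> (s', t') \<in> com_sem M c' \<longrightarrow>
      (s, s') \<in> R \<longrightarrow> (t, t') \<in> S)"


section \<open>The rules of RHL+\<close>

text \<open>
  \<open>rhl_rule M J j\<close> means that some rule instance whose side conditions hold has the set \<open>J\<close> of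
  premises and the conclusion \<open>j\<close>. This is the set of single rule instances, not
  derivability.
\<close>

inductive rhl_rule ::
  "('f, 'p) lang \<Rightarrow> ('v, 'f, 'p) rjudg set \<Rightarrow> ('v, 'f, 'p) rjudg \<Rightarrow> bool" for M where
  rGhost: "ghost x c \<Longrightarrow> ghost x' c' \<Longrightarrow> indep x x' R \<Longrightarrow> indep x x' S \<Longrightarrow>
    rhl_rule M {Judg c c' R S} (Judg (erase x c) (erase x' c') R S)"
| rRewrite: "com_equiv M c d \<Longrightarrow> com_equiv M c' d' \<Longrightarrow>
    rhl_rule M {Judg c c' R S} (Judg d d' R S)"
| rSkip: "rhl_rule M {} (Judg Skip Skip R R)"
| rAsgnSkip: "rhl_rule M {} (Judg (Asgn x e) Skip (subst_left M R x e) R)"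
| rSkipAsgn: "rhl_rule M {} (Judg Skip (Asgn x e) (subst_right M R x e) R)"
| rHavSkip: "rhl_rule M {} (Judg (Havoc x) Skip (all_left x P) P)"
| rSkipHav: "rhl_rule M {} (Judg Skip (Havoc x) (all_right x P) P)"
| rSeq: "rhl_rule M {Judg c c' R S, Judg d d' S T} (Judg (Seq c d) (Seq c' d') R T)"
| rIf: "rhl_rule M
    {Judg c c' (R \<inter> on_left M e \<inter> on_right M e') S | e c e' c'.
      (e, c) \<in> gset gs \<and> (e', c') \<in> gset gs'}
    (Judg (IfFi gs) (IfFi gs') R S)"
| rDo: "Q \<subseteq> agree M (enab gs) (enab gs') \<union> (L \<inter> on_left M (enab gs))
      \<union> (R \<inter> on_right M (enab gs')) \<Longrightarrow>
    rhl_rule M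
    ({Judg c Skip (Q \<inter> on_left M e \<inter> L) Q | e c. (e, c) \<in> gset gs}
      \<union> {Judg Skip c' (Q \<inter> on_right M e' \<inter> R) Q | e' c'. (e', c') \<in> gset gs'}
      \<union> {Judg c c' (Q \<inter> on_left M e \<inter> on_right M e' \<inter> - L \<inter> - R) Q | e c e' c'.
          (e, c) \<in> gset gs \<and> (e', c') \<in> gset gs'})
    (Judg (DoOd gs) (DoOd gs') Q (Q \<inter> - on_left M (enab gs) \<inter> - on_right M (enab gs')))"
| rConseq: "P \<subseteq> R \<Longrightarrow> S \<subseteq> Q \<Longrightarrow> rhl_rule M {Judg c d R S} (Judg c d P Q)"
| rDisj: "rhl_rule M {Judg c d Q S, Judg c d R S} (Judg c d (Q \<union> R) S)"
| rFalse: "rhl_rule M {} (Judg c d {} R)"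

end

theory Submission
  imports Defs
begin

text \<open>
  Interpreting KAT expressions as store relations gives a model of the KAT axioms and of Hyp, in
  which a translated command denotes its own semantics; so equivalent commands have equal
  semantics, which is rRewrite. For rGhost, every run of an erased command lifts to a run of the
  original one whose stores differ only in the ghost variable. For rDo, induction on the total
  number of iterations on both sides: the side condition ensures that in any pair of stores that
  is not final on both sides, a left, right or joint step preserving the invariant can be taken.
\<close>

section \<open>Expressions\<close>

lemma ieval_isubst: "ieval M (isubst x e a) s = ieval M a (s(x := ieval M e s))"
  by (induction a) (auto simp: comp_def cong: map_cong)

lemma beval_bsubst: "beval M (bsubst x e b) s = beval M b (s(x := ieval M e s))"
  by (induction M b s rule: beval.induct) (auto simp: ieval_isubst comp_def simp del: fun_upd_apply)

lemma ieval_fresh: "x \<notin> ivars e \<Longrightarrow> ieval M e (s(x := v)) = ieval M e s"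
proof (induction e)
  case (IApp f es)
  then have "map (\<lambda>e. ieval M e (s(x := v))) es = map (\<lambda>e. ieval M e s) es"
    by (auto simp del: fun_upd_apply)
  then show ?case by (simp only: ieval.simps)
qed simp

lemma beval_fresh: "x \<notin> bvars b \<Longrightarrow> beval M b (s(x := v)) = beval M b s"
proof (induction M b s rule: beval.induct)
  case (1 M p es s)
  then have "map (\<lambda>e. ieval M e (s(x := v))) es = map (\<lambda>e. ieval M e s) es"
    by (auto simp: ieval_fresh)
  then show ?case by (simp only: beval.simps)
qed auto

lemma gcs_sem_iff:
  "(s, t) \<in> gcs_sem M gs \<longleftrightarrow> (\<exists>e c. (e, c) \<in> gset gs \<and> beval M e s \<and> (s, t) \<in> com_sem M c)"
  \<comment> \<open>The mutual induction rule is given a trivial predicate on the command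
    side.\<close>
  by (induction gs rule: gcs.induct[of "\<lambda>_. True"]) auto

lemma gset_enab: "(e, c) \<in> gset gs \<Longrightarrow> beval M e s \<Longrightarrow> beval M (enab gs) s"
  by (induction gs rule: gcs.induct[of "\<lambda>_. True"]) auto

lemma gcs_sem_enab: "(s, t) \<in> gcs_sem M gs \<Longrightarrow> beval M (enab gs) s"
  by (auto simp: gcs_sem_iff intro: gset_enab)

section \<open>The relational model of KAT\<close>

text \<open>
  On expressions that are not tests, \<open>KNot\<close> has no intended meaning; the clause below is
  a total choice that agrees with complement relative to the identity on tests.
\<close>

primrec ksem :: "('f, 'p) lang \<Rightarrow> ('v, 'f, 'p) kat \<Rightarrow> 'v srel" where
  "ksem M (KPrim b) = {(s, t). t = s \<and> beval M (BPrim b) s}"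
| "ksem M (KAsgn x e) = com_sem M (Asgn x e :: ('v, 'f, 'p) com)"
| "ksem M (KHavoc x) = com_sem M (Havoc x :: ('v, 'f, 'p) com)"
| "ksem M (KPlus E F) = ksem M E \<union> ksem M F"
| "ksem M (KSeq E F) = ksem M E O ksem M F"
| "ksem M (KStar E) = (ksem M E)\<^sup>*"
| "ksem M (KNot E) = Id - ksem M E"
| "ksem M KOne = Id"
| "ksem M KZero = {}"

primrec holds :: "('f, 'p) lang \<Rightarrow> ('v, 'f, 'p) form \<Rightarrow> bool" where
  "holds M (Eq E F) \<longleftrightarrow> ksem M E = ksem M F"
| "holds M Falsum \<longleftrightarrow> False"
| "holds M (Imp \<phi> \<psi>) \<longleftrightarrow> (holds M \<phi> \<longrightarrow> holds M \<psi>)"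

text \<open>Below \<open>Id\<close>, composition is intersection, so tests obey the Boolean
  axioms.\<close>

lemma ksem_test: "is_test E \<Longrightarrow> ksem M E \<subseteq> Id"
  by (induction E) auto

lemma ksem_btrans: "ksem M (btrans e) = {(s, t). t = s \<and> beval M e s}"
  by (induction e) auto

lemma
  fixes c :: "('v, 'f, 'p) com" and gs :: "('v, 'f, 'p) gcs"
  shows ksem_ctrans: "ksem M (ctrans c) = com_sem M c"
    and ksem_gtrans: "ksem M (gtrans gs) = gcs_sem M gs"
  by (induction c and gs) (auto simp: ksem_btrans)

text \<open>The star induction law for relations: absorb the steps of \<open>E\<close> into
  \<open>G\<close> one by one, starting with the last.\<close>

lemma rtrancl_least_left:
  assumes "F \<union> E O G \<subseteq> G"
  shows "E\<^sup>* O F \<subseteq> G"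
proof -
  have "(s, t) \<in> E\<^sup>* \<Longrightarrow> (t, u) \<in> F \<Longrightarrow> (s, u) \<in> G" for s t u
    by (induction rule: converse_rtrancl_induct) (use assms in auto)
  then show ?thesis by auto
qed

lemma rtrancl_least_right:
  assumes "F \<union> G O E \<subseteq> G"
  shows "F O E\<^sup>* \<subseteq> G"
proof -
  have "(t, u) \<in> E\<^sup>* \<Longrightarrow> (s, t) \<in> F \<Longrightarrow> (s, u) \<in> G" for s t u
    by (induction rule: rtrancl_induct) (use assms in auto)
  then show ?thesis by auto
qed

lemma kat_axiom_holds: "kat_axiom \<phi> \<Longrightarrow> holds M \<phi>"
proof (induction rule: kat_axiom.induct)
  case (test_comm A B)
  then show ?case using ksem_test[of A M] ksem_test[of B M] by auto
next
  case (test_distrib A B C)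
  then show ?case using ksem_test[of A M] ksem_test[of B M] ksem_test[of C M] by auto
next
  case (test_contradiction A)
  then show ?case using ksem_test[of A M] by auto
next
  case (test_excluded_middle A)
  then show ?case using ksem_test[of A M] by auto
next
  case (star_unfold_left E)
  \<comment> \<open>\<open>rtrancl_unfold\<close> splits off a last step; a relation commutes with
    its closure.\<close>
  show ?case by (simp add: rtrancl_unfold[symmetric] r_comp_rtrancl_eq)
next
  case (star_unfold_right E)
  show ?case by (simp add: rtrancl_unfold[symmetric])
next
  case (star_induct_left F E G)
  show ?case
    using rtrancl_least_left[of "ksem M F" "ksem M E" "ksem M G"] by (simp add: subset_Un_eq)
next
  case (star_induct_right F G E)
  show ?case
    using rtrancl_least_right[of "ksem M F" "ksem M G" "ksem M E"] by (simp add: subset_Un_eq)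
qed auto

text \<open>Each equation in Hyp says that no store pair passes its tests; for assignments,
  substitution becomes store update.\<close>

lemma hyp_holds: "hyp M \<phi> \<Longrightarrow> holds M \<phi>"
  by (induction rule: hyp.induct) (auto simp: ksem_btrans beval_bsubst)

text \<open>Connectives are read classically and \<open>ksem\<close> is compositional, so congruence
  holds for \<open>KNot\<close> even outside tests.\<close>

lemma provable_holds: "provable M \<phi> \<Longrightarrow> holds M \<phi>"
  by (induction rule: provable.induct) (auto simp: kat_axiom_holds hyp_holds)

lemma com_equiv_sem: "com_equiv M c d \<Longrightarrow> com_sem M c = com_sem M d"
  unfolding com_equiv_def by (drule provable_holds) (simp add: ksem_ctrans)

section \<open>Ghost erasure\<close>

lemma enab_erase: "enab (erase_gcs x gs) = enab gs"
  by (induction gs rule: gcs.induct[of "\<lambda>_. True"]) auto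

lemma ghost_gcs_enab: "ghost_gcs x gs \<Longrightarrow> x \<notin> bvars (enab gs)"
  by (induction gs rule: gcs.induct[of "\<lambda>_. True"]) auto

text \<open>A simulation up to the value of \<open>x\<close>. Lifting must work from every ghost
  value, since each step starts from the one its predecessor left.\<close>

lemma rtrancl_erase_lift:
  assumes "(s, t) \<in> A\<^sup>*"
    and lift: "\<And>s t v. (s, t) \<in> A \<Longrightarrow> \<exists>w. (s(x := v), t(x := w)) \<in> B"
  shows "\<exists>w. (s(x := v), t(x := w)) \<in> B\<^sup>*"
  using assms(1)
proof (induction rule: rtrancl_induct)
  case (step t u)
  then obtain w where "(s(x := v), t(x := w)) \<in> B\<^sup>*" by blast
  moreover obtain w' where "(t(x := w), u(x := w')) \<in> B" using lift[OF step(2)] by blast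
  ultimately show ?case by (meson rtrancl.rtrancl_into_rtrancl)
qed blast

text \<open>Guards and right-hand sides do not read \<open>x\<close>, so the original command can
  follow the same path from any ghost value \<open>v\<close>; \<open>w\<close> is whatever value it
  leaves in \<open>x\<close>.\<close>

lemma erase_lift:
  "ghost x c \<Longrightarrow> (s, t) \<in> com_sem M (erase x c) \<Longrightarrow> \<exists>w. (s(x := v), t(x := w)) \<in> com_sem M c"
  and erase_gcs_lift: "ghost_gcs x gs \<Longrightarrow> (s, t) \<in> gcs_sem M (erase_gcs x gs) \<Longrightarrow>
    \<exists>w. (s(x := v), t(x := w)) \<in> gcs_sem M gs"
proof (induction c and gs arbitrary: s t v and s t v)
  case (Asgn y e)
  show ?case
  proof (cases "y = x")
    case False
    with Asgn have "(s(x := v), t(x := v)) \<in> com_sem M (Asgn y e)"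
      by (simp add: ieval_fresh fun_upd_twist)
    then show ?thesis ..
  \<comment> \<open>For \<open>y = x\<close> the erased command is \<open>Skip\<close>, so
    \<open>s = t\<close>, and \<open>w\<close> is the assigned value.\<close>
  qed (use Asgn in \<open>auto simp del: fun_upd_apply\<close>)
next
  case (Havoc y)
  show ?case
  proof (cases "y = x")
    case False
    with Havoc obtain a where "t(x := v) = s(x := v, y := a)"
      by (auto simp: fun_upd_twist)
    then have "(s(x := v), t(x := v)) \<in> com_sem M (Havoc y)" by auto
    then show ?thesis ..
  qed (use Havoc in \<open>auto simp del: fun_upd_apply\<close>)
next
  case (Seq c d)
  from Seq.prems(2) obtain u
    where u: "(s, u) \<in> com_sem M (erase x c)" "(u, t) \<in> com_sem M (erase x d)"
    by auto
  obtain w where "(s(x := v), u(x := w)) \<in> com_sem M c"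
    using Seq.IH(1) Seq.prems(1) u(1) by fastforce
  moreover obtain w' where "(u(x := w), t(x := w')) \<in> com_sem M d"
    using Seq.IH(2) Seq.prems(1) u(2) by fastforce
  ultimately have "(s(x := v), t(x := w')) \<in> com_sem M (Seq c d)"
    unfolding com_sem.simps by (rule relcompI)
  then show ?case ..
next
  case (DoOd gs)
  then have run: "(s, t) \<in> (gcs_sem M (erase_gcs x gs))\<^sup>*" and "ghost_gcs x gs" by simp_all
  then have "\<exists>w. (s(x := v), t(x := w)) \<in> (gcs_sem M gs)\<^sup>*"
    by (intro rtrancl_erase_lift[OF run] DoOd.IH)
  then show ?case
    using DoOd.prems by (simp add: enab_erase beval_fresh ghost_gcs_enab del: fun_upd_apply)
next
  case (GLast e c)
  then show ?case by (simp add: beval_fresh del: fun_upd_apply)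
next
  case (GCons e c gs)
  then show ?case by (simp add: beval_fresh del: fun_upd_apply) blast
qed (auto simp del: fun_upd_apply)

lemma indepD: "indep x x' R \<Longrightarrow> (s(x := v), s'(x' := v')) \<in> R \<Longrightarrow> (s, s') \<in> R"
  unfolding indep_def by auto

lemma valid_erase:
  assumes "ghost x c" "ghost x' c'" "indep x x' S" and valid: "valid M (Judg c c' R S)"
  shows "valid M (Judg (erase x c) (erase x' c') R S)"
proof (simp, intro allI impI)
  fix s t s' t'
  assume run: "(s, t) \<in> com_sem M (erase x c)" "(s', t') \<in> com_sem M (erase x' c')"
    and R: "(s, s') \<in> R"
  \<comment> \<open>Lifting at the current value \<open>s x\<close> leaves the initial store
    unchanged, so the precondition still applies.\<close>
  obtain w where w: "(s, t(x := w)) \<in> com_sem M c"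
    using erase_lift[OF assms(1) run(1), of "s x"] by auto
  obtain w' where w': "(s', t'(x' := w')) \<in> com_sem M c'"
    using erase_lift[OF assms(2) run(2), of "s' x'"] by auto
  have "(t(x := w), t'(x' := w')) \<in> S"
    using valid w w' R by auto
  then show "(t, t') \<in> S" by (rule indepD[OF assms(3)])
qed

section \<open>Loops\<close>

text \<open>\<open>A\<close> and \<open>A'\<close> are single iterations, \<open>p\<close> and
  \<open>p'\<close> the loop guards. Iterations are counted by relation powers because a one-sided
  step shortens only one run; the sum \<open>m + n\<close> still decreases.\<close>

lemma loops_preserve:
  assumes left: "\<And>s u s'. (s, u) \<in> A \<Longrightarrow> (s, s') \<in> Q \<Longrightarrow> (s, s') \<in> L \<Longrightarrow> (u, s') \<in> Q"
    and right: "\<And>s s' u'. (s', u') \<in> A' \<Longrightarrow> (s, s') \<in> Q \<Longrightarrow> (s, s') \<in> R \<Longrightarrow> (s, u') \<in> Q"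
    and joint: "\<And>s u s' u'. (s, u) \<in> A \<Longrightarrow> (s', u') \<in> A' \<Longrightarrow> (s, s') \<in> Q \<Longrightarrow>
      (s, s') \<notin> L \<Longrightarrow> (s, s') \<notin> R \<Longrightarrow> (u, u') \<in> Q"
    and side: "\<And>s s'. (s, s') \<in> Q \<Longrightarrow>
      p s = p' s' \<or> (s, s') \<in> L \<and> p s \<or> (s, s') \<in> R \<and> p' s'"
    and enabled: "\<And>s u. (s, u) \<in> A \<Longrightarrow> p s" "\<And>s u. (s, u) \<in> A' \<Longrightarrow> p' s"
    and final: "\<not> p t" "\<not> p' t'"
  shows "(s, t) \<in> A ^^ m \<Longrightarrow> (s', t') \<in> A' ^^ n \<Longrightarrow> (s, s') \<in> Q \<Longrightarrow> (t, t') \<in> Q"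
proof (induction "m + n" arbitrary: m n s s' rule: less_induct)
  case less
  \<comment> \<open>As \<open>p\<close> fails at \<open>t\<close>, the run is nonempty.
    \<open>relpow_Suc_D2\<close> peels off its first step, whereas \<open>relpow.simps(2)\<close>
    would peel off the last.\<close>
  have step_left: "\<exists>u k. m = Suc k \<and> (s, u) \<in> A \<and> (u, t) \<in> A ^^ k" if "p s"
    using less.prems(1) final that by (cases m) (auto simp del: relpow.simps(2) dest: relpow_Suc_D2)
  have step_right: "\<exists>u k. n = Suc k \<and> (s', u) \<in> A' \<and> (u, t') \<in> A' ^^ k" if "p' s'"
    using less.prems(2) final that by (cases n) (auto simp del: relpow.simps(2) dest: relpow_Suc_D2)
  \<comment> \<open>If both guards are true, \<open>L\<close> or \<open>R\<close> selects a
    one-sided step and otherwise the step is joint; if they differ, \<open>side\<close> supplies the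
    one-sided step.\<close>
  consider (left) "p s" "(s, s') \<in> L" | (right) "p' s'" "(s, s') \<in> R"
    | (joint) "p s" "p' s'" "(s, s') \<notin> L" "(s, s') \<notin> R" | (stop) "\<not> p s" "\<not> p' s'"
    using side[OF less.prems(3)] by blast
  then show ?case
  proof cases
    case left
    then obtain u k where u: "m = Suc k" "(s, u) \<in> A" "(u, t) \<in> A ^^ k"
      using step_left by blast
    then have "(u, s') \<in> Q" using assms(1) less.prems(3) left by blast
    with less.hyps[of k n u s'] less.prems u show ?thesis by simp
  next
    case right
    then obtain u k where u: "n = Suc k" "(s', u) \<in> A'" "(u, t') \<in> A' ^^ k"
      using step_right by blast
    then have "(s, u) \<in> Q" using assms(2) less.prems(3) right by blast
    with less.hyps[of m k s u] less.prems u show ?thesis by simp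
  next
    case joint
    obtain u k where u: "m = Suc k" "(s, u) \<in> A" "(u, t) \<in> A ^^ k"
      using step_left joint by blast
    obtain u' k' where u': "n = Suc k'" "(s', u') \<in> A'" "(u', t') \<in> A' ^^ k'"
      using step_right joint by blast
    have "(u, u') \<in> Q" using assms(3) less.prems(3) joint u u' by blast
    with less.hyps[of k k' u u'] u u' show ?thesis by simp
  next
    case stop
    \<comment> \<open>A nonempty run would begin with a step, making its guard true by
      \<open>enabled\<close>.\<close>
    then have "m = 0" "n = 0"
      using less.prems enabled by (metis not0_implies_Suc relpow_Suc_D2)+
    with less.prems show ?thesis by simp
  qed
qed

lemma valid_do:
  assumes side: "Q \<subseteq> agree M (enab gs) (enab gs') \<union> (L \<inter> on_left M (enab gs))
      \<union> (R \<inter> on_right M (enab gs'))"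
    and left: "\<And>e c. (e, c) \<in> gset gs \<Longrightarrow> valid M (Judg c Skip (Q \<inter> on_left M e \<inter> L) Q)"
    and right: "\<And>e' c'. (e', c') \<in> gset gs' \<Longrightarrow>
      valid M (Judg Skip c' (Q \<inter> on_right M e' \<inter> R) Q)"
    and joint: "\<And>e c e' c'. (e, c) \<in> gset gs \<Longrightarrow> (e', c') \<in> gset gs' \<Longrightarrow>
      valid M (Judg c c' (Q \<inter> on_left M e \<inter> on_right M e' \<inter> - L \<inter> - R) Q)"
  shows "valid M (Judg (DoOd gs) (DoOd gs') Q
    (Q \<inter> - on_left M (enab gs) \<inter> - on_right M (enab gs')))"
proof -
  have "(t, t') \<in> Q"
    if runs: "(s, t) \<in> (gcs_sem M gs)\<^sup>*" "\<not> beval M (enab gs) t"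
      "(s', t') \<in> (gcs_sem M gs')\<^sup>*" "\<not> beval M (enab gs') t'" "(s, s') \<in> Q" for s t s' t'
  proof -
    obtain m n where "(s, t) \<in> gcs_sem M gs ^^ m" "(s', t') \<in> gcs_sem M gs' ^^ n"
      using runs(1,3) by (auto dest!: rtrancl_imp_relpow)
    then show ?thesis
    \<comment> \<open>The rotation puts the three run premises first, where the chained runs are
      matched.\<close>
    proof (rule loops_preserve[where L = L and R = R and p = "beval M (enab gs)"
          and p' = "beval M (enab gs')", rotated -3])
      show "(u, s') \<in> Q" if "(s, u) \<in> gcs_sem M gs" "(s, s') \<in> Q" "(s, s') \<in> L" for s u s'
        using that left by (fastforce simp: gcs_sem_iff on_left_def)
      show "(s, u') \<in> Q" if "(s', u') \<in> gcs_sem M gs'" "(s, s') \<in> Q" "(s, s') \<in> R" for s s' u'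
        using that right by (fastforce simp: gcs_sem_iff on_right_def)
      show "(u, u') \<in> Q" if "(s, u) \<in> gcs_sem M gs" "(s', u') \<in> gcs_sem M gs'"
        "(s, s') \<in> Q" "(s, s') \<notin> L" "(s, s') \<notin> R" for s u s' u'
      proof -
        obtain e c where "(e, c) \<in> gset gs" "beval M e s" "(s, u) \<in> com_sem M c"
          using \<open>(s, u) \<in> gcs_sem M gs\<close> by (auto simp: gcs_sem_iff)
        moreover obtain e' c'
          where "(e', c') \<in> gset gs'" "beval M e' s'" "(s', u') \<in> com_sem M c'"
          using \<open>(s', u') \<in> gcs_sem M gs'\<close> by (auto simp: gcs_sem_iff)
        ultimately show ?thesis
          using joint[of e c e' c'] that by (simp add: on_left_def on_right_def)
      qed
      show "beval M (enab gs) s = beval M (enab gs') s'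
          \<or> (s, s') \<in> L \<and> beval M (enab gs) s \<or> (s, s') \<in> R \<and> beval M (enab gs') s'"
        if "(s, s') \<in> Q" for s s'
        using that side by (auto simp: agree_def on_left_def on_right_def)
    qed (use runs in \<open>auto intro: gcs_sem_enab\<close>)
  qed
  \<comment> \<open>The negated guards of the postcondition are the exit conditions of the two
    loops.\<close>
  then show ?thesis by (auto simp: on_left_def on_right_def)
qed

section \<open>Soundness\<close>

theorem theorem5p8:
  fixes M :: "('f, 'p) lang"
    and J :: "('v, 'f, 'p) rjudg set"
    and j :: "('v, 'f, 'p) rjudg"
  assumes "rhl_rule M J j"
    and "\<forall>k \<in> insert j J. wf_rjudg M k"
    and "\<forall>k \<in> J. valid M k"
  shows "valid M j"
  using assms(1,3)
proof (induction rule: rhl_rule.induct)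
  case (rGhost x c x' c' R S)
  then show ?case by (intro valid_erase) auto
next
  case (rRewrite c d c' d' R S)
  then show ?case by (simp add: com_equiv_sem)
next
  case (rSeq c c' R S d d' T)
  then have c: "valid M (Judg c c' R S)" and d: "valid M (Judg d d' S T)" by auto
  show ?case unfolding valid.simps com_sem.simps
  proof (intro allI impI, elim relcompEpair)
    fix s t s' t' u u'
    assume "(s, s') \<in> R" "(s, u) \<in> com_sem M c" "(s', u') \<in> com_sem M c'"
    then have "(u, u') \<in> S" using c by simp
    moreover assume "(u, t) \<in> com_sem M d" "(u', t') \<in> com_sem M d'"
    ultimately show "(t, t') \<in> T" using d by simp
  qed
next
  case (rIf R S gs gs')
  show ?case
  proof (simp, intro allI impI)
    fix s t s' t'
    assume run: "(s, t) \<in> gcs_sem M gs" "(s', t') \<in> gcs_sem M gs'" and R: "(s, s') \<in> R"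
    obtain e c where c: "(e, c) \<in> gset gs" "beval M e s" "(s, t) \<in> com_sem M c"
      using run(1) by (auto simp: gcs_sem_iff)
    obtain e' c' where c': "(e', c') \<in> gset gs'" "beval M e' s'" "(s', t') \<in> com_sem M c'"
      using run(2) by (auto simp: gcs_sem_iff)
    have "valid M (Judg c c' (R \<inter> on_left M e \<inter> on_right M e') S)"
      using rIf c c' by blast
    then show "(t, t') \<in> S"
      using c c' R by (simp add: on_left_def on_right_def)
  qed
next
  case (rDo Q gs gs' L R)
  show ?case
    \<comment> \<open>Each premise of \<open>valid_do\<close> is one member of the three-part
      premise set.\<close>
    by (rule valid_do[OF rDo.hyps]; rule bspec[OF rDo.prems]) blast+
next
  case (rConseq P R S Q c d)
  then have "valid M (Judg c d R S)" by simp
  with rConseq.hyps show ?case unfolding valid.simps by blast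
next
  case (rDisj c d Q S R)
  then have "valid M (Judg c d Q S)" "valid M (Judg c d R S)" by simp_all
  then show ?case unfolding valid.simps by blast
qed (auto simp: subst_left_def subst_right_def all_left_def all_right_def)

end
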